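(* For $n\ge1$ and integers $m,k$ let $g_n(m,k)=\#\{t\in\mathfrak T_{2n+1}:\mathrm{eoc}(t)=m,\ \mathrm{pom}(t)=k\}$, $g_n(m,\bullet)=\sum_{k}g_n(m,k)$ and $g_n(\bullet,k)=\sum_m g_n(m,k)$. Then for every $n\ge2$: (1) $g_n(m,2n)=0$ for all $1\le m\le 2n$; $g_n(m,2n-1)=g_{n-1}(m,\bullet)$ for $1\le m\le 2n-2$; and $g_n(2n-1,2n-1)=g_n(2n,2n-1)=0$; (2) $g_n(2n,k)=g_{n-1}(k,\bullet)$ for $1\le k\le 2n-2$ and $g_n(2n,2n-1)=g_n(2n,2n)=0$; moreover $g_n(2n-1,k)=g_{n-1}(k,\bullet)+g_{n-1}(\bullet,k)$ for $1\le k\le 2n-2$ and $g_n(2n-1,2n-1)=g_n(2n-1,2n)=0$.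
   Context: A strictly ordered binary tree on $N$ vertices is a rooted tree whose vertices are labeled bijectively by $1,\dots,N$, the root being labeled $1$, in which every vertex has either no child (a leaf) or exactly two children (their order is immaterial), and labels increase along every path from the root. $\mathfrak T_{2n+1}$ denotes the set of these trees on $2n+1$ vertices. For $t\in\mathfrak T_{2n+1}$ ($n\ge1$): the minimal chain starts at the root and repeatedly moves to the child with the smaller label until a leaf is reached; $\mathrm{eoc}(t)$ is the label of that leaf. The vertex $2n+1$ is a leaf, and $\mathrm{pom}(t)$ is the label of its parent. *)

theory Defs
  imports Main "HOL-Library.Groups_Big_Fun"
begin

text \<open>
  A rooted tree is given by its set of (parent, child) edges. Since vertices are labelled
  bijectively, each vertex is identified with its label.
\<close>

definition rooted_tree :: "'v set \<Rightarrow> 'v \<Rightarrow> ('v \<times> 'v) set \<Rightarrow> bool" where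
  "rooted_tree V r E \<longleftrightarrow>
     r \<in> V \<and> E \<subseteq> V \<times> V \<and>
     (\<forall>u. (u, r) \<notin> E) \<and>
     (\<forall>v \<in> V - {r}. \<exists>!u. (u, v) \<in> E) \<and>
     (\<forall>v \<in> V. (r, v) \<in> E\<^sup>*)"

definition children :: "('v \<times> 'v) set \<Rightarrow> 'v \<Rightarrow> 'v set" where
  "children E v = E `` {v}"

definition is_leaf :: "('v \<times> 'v) set \<Rightarrow> 'v \<Rightarrow> bool" where
  "is_leaf E v \<longleftrightarrow> children E v = {}"

definition ordered_binary_trees :: "nat \<Rightarrow> (nat \<times> nat) set set" where
  "ordered_binary_trees N =
     {E. rooted_tree {1..N} 1 E \<and>
         (\<forall>v \<in> {1..N}. is_leaf E v \<or> card (children E v) = 2) \<and>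
         (\<forall>(u, v) \<in> E. u < v)}"

definition min_chain_step :: "('v::linorder \<times> 'v) set \<Rightarrow> ('v \<times> 'v) set" where
  "min_chain_step E = {(v, Min (children E v)) | v. \<not> is_leaf E v}"

definition eoc :: "(nat \<times> nat) set \<Rightarrow> nat" where
  "eoc E = (THE l. (1, l) \<in> (min_chain_step E)\<^sup>* \<and> is_leaf E l)"

definition pom :: "nat \<Rightarrow> (nat \<times> nat) set \<Rightarrow> nat" where
  "pom n E = (THE p. (p, 2 * n + 1) \<in> E)"

definition g :: "nat \<Rightarrow> int \<Rightarrow> int \<Rightarrow> nat" where
  "g n m k = card {E \<in> ordered_binary_trees (2 * n + 1). int (eoc E) = m \<and> int (pom n E) = k}"

text \<open>
  The marginals sum over all integers; \<^const>\<open>Sum_any\<close> sums over the support, which is finite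
  because there are only finitely many trees (see \<open>finite_g_support\<close> below).
\<close>

definition g_row :: "nat \<Rightarrow> int \<Rightarrow> nat" where
  "g_row n m = Sum_any (\<lambda>k. g n m k)"

definition g_col :: "nat \<Rightarrow> int \<Rightarrow> nat" where
  "g_col n k = Sum_any (\<lambda>m. g n m k)"

lemma finite_ordered_binary_trees: "finite (ordered_binary_trees N)"
proof (rule finite_subset)
  show "ordered_binary_trees N \<subseteq> Pow ({1..N} \<times> {1..N})"
    by (auto simp: ordered_binary_trees_def rooted_tree_def)
qed simp

lemma finite_g_support:
  "finite {k. g n m k \<noteq> 0}" "finite {m. g n m k \<noteq> 0}"
proof -
  let ?T = "ordered_binary_trees (2 * n + 1)"
  have "\<exists>E \<in> ?T. int (eoc E) = m \<and> int (pom n E) = k" if "g n m k \<noteq> 0" for m k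
  proof -
    have "{E \<in> ?T. int (eoc E) = m \<and> int (pom n E) = k} \<noteq> {}"
      using that unfolding g_def by (metis card.empty)
    then show ?thesis by blast
  qed
  then have "{k. g n m k \<noteq> 0} \<subseteq> (\<lambda>E. int (pom n E)) ` ?T"
    and "{m. g n m k \<noteq> 0} \<subseteq> (\<lambda>E. int (eoc E)) ` ?T"
    by blast+
  then show "finite {k. g n m k \<noteq> 0}" "finite {m. g n m k \<noteq> 0}"
    using finite_ordered_binary_trees finite_subset by blast+
qed

lemma pom_unique:
  assumes "E \<in> ordered_binary_trees (2 * n + 1)" "n \<ge> 1"
  shows "\<exists>!p. (p, 2 * n + 1) \<in> E"
proof -
  have "2 * n + 1 \<in> {1..2 * n + 1} - {1}" using assms(2) by simp
  then show ?thesis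
    using assms(1) unfolding ordered_binary_trees_def rooted_tree_def by blast
qed

lemma eoc_unique:
  assumes E: "E \<in> ordered_binary_trees N"
  shows "\<exists>!l. (1, l) \<in> (min_chain_step E)\<^sup>* \<and> is_leaf E l"
proof (rule ex_ex1I)
  have sub: "E \<subseteq> {1..N} \<times> {1..N}" and inc: "\<And>u v. (u, v) \<in> E \<Longrightarrow> u < v"
    using E by (auto simp: ordered_binary_trees_def rooted_tree_def)
  have "\<exists>l. (v, l) \<in> (min_chain_step E)\<^sup>* \<and> is_leaf E l" for v
  proof (induction "N - v" arbitrary: v rule: less_induct)
    case less
    show ?case
    proof (cases "is_leaf E v")
      case False
      let ?w = "Min (children E v)"
      have "children E v \<subseteq> {1..N}" using sub by (auto simp: children_def)
      then have "?w \<in> children E v"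
        using False finite_subset by (metis Min_in finite_atLeastAtMost is_leaf_def)
      then have "(v, ?w) \<in> E" by (simp add: children_def)
      then have "N - ?w < N - v" using inc[of v ?w] sub by force
      then obtain l where "(?w, l) \<in> (min_chain_step E)\<^sup>*" "is_leaf E l"
        using less by blast
      moreover have "(v, ?w) \<in> min_chain_step E" using False by (auto simp: min_chain_step_def)
      ultimately show ?thesis by (meson converse_rtrancl_into_rtrancl)
    qed blast
  qed
  then show "\<exists>l. (1, l) \<in> (min_chain_step E)\<^sup>* \<and> is_leaf E l" .
next
  fix l l'
  assume l: "(1, l) \<in> (min_chain_step E)\<^sup>* \<and> is_leaf E l"
    and l': "(1, l') \<in> (min_chain_step E)\<^sup>* \<and> is_leaf E l'"
  have "single_valued (min_chain_step E)"
    by (auto simp: single_valued_def min_chain_step_def)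
  then have "(l, l') \<in> (min_chain_step E)\<^sup>* \<or> (l', l) \<in> (min_chain_step E)\<^sup>*"
    using l l' single_valued_confluent by fast
  moreover have "x = y" if "(x, y) \<in> (min_chain_step E)\<^sup>*" "is_leaf E x" for x y
    using that by (cases rule: converse_rtranclE) (auto simp: min_chain_step_def)
  ultimately show "l = l'" using l l' by metis
qed

end

theory Submission
  imports Defs
begin

text \<open>
  Attaching two new labels \<open>a < b\<close> as children of a leaf \<open>l\<close> changes the end of the minimal
  chain only if it was \<open>l\<close>, in which case it becomes \<open>a\<close>. In a tree on \<open>{1..2n+1}\<close> whose chain
  ends at \<open>2n\<close> or \<open>2n - 1\<close>, or whose maximum hangs from \<open>2n - 1\<close>, two of the three
  largest labels are sibling leaves. Pruning them leaves a tree with two vertices fewer, up to an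
  order-preserving change of its largest label; this is why trees on arbitrary label sets are
  considered. The marginals appear because the pruned tree is constrained in only one statistic.
\<close>

section \<open>Increasing binary trees on an arbitrary label set\<close>

definition increasing_trees :: "nat set \<Rightarrow> (nat \<times> nat) set set" where
  "increasing_trees V =
     {E. 1 \<in> V \<and> E \<subseteq> V \<times> V \<and> (\<forall>u. (u, 1) \<notin> E) \<and>
         (\<forall>v \<in> V - {1}. \<exists>!u. (u, v) \<in> E) \<and>
         (\<forall>v \<in> V. is_leaf E v \<or> card (children E v) = 2) \<and>
         (\<forall>(u, v) \<in> E. u < v)}"

lemma increasing_treesI:
  assumes "1 \<in> V" "E \<subseteq> V \<times> V" "\<And>u. (u, 1) \<notin> E"
    and "\<And>v. v \<in> V \<Longrightarrow> v \<noteq> 1 \<Longrightarrow> \<exists>!u. (u, v) \<in> E"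
    and "\<And>v. v \<in> V \<Longrightarrow> \<not> is_leaf E v \<Longrightarrow> card (children E v) = 2"
    and "\<And>u v. (u, v) \<in> E \<Longrightarrow> u < v"
  shows "E \<in> increasing_trees V"
  using assms unfolding increasing_trees_def by blast

context
  fixes V E
  assumes E: "E \<in> increasing_trees V"
begin

lemma increasing_trees_root: "1 \<in> V"
  and increasing_trees_root_no_parent: "(u, 1) \<notin> E"
  and increasing_trees_edge:
    "(u, v) \<in> E \<Longrightarrow> u \<in> V" "(u, v) \<in> E \<Longrightarrow> v \<in> V" "(u, v) \<in> E \<Longrightarrow> u < v"
  and increasing_trees_parent: "v \<in> V \<Longrightarrow> v \<noteq> 1 \<Longrightarrow> \<exists>!u. (u, v) \<in> E"
  and increasing_trees_card_children: "\<not> is_leaf E v \<Longrightarrow> card (children E v) = 2"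
  \<comment> \<open>The last fact needs no \<open>v \<in> V\<close>: a vertex outside
    \<open>V\<close> has no outgoing edge and so counts as a leaf.\<close>
  using E unfolding increasing_trees_def is_leaf_def children_def by blast+

lemma increasing_trees_parent_unique: "(u, v) \<in> E \<Longrightarrow> (u', v) \<in> E \<Longrightarrow> u = u'"
  using increasing_trees_parent[of v] increasing_trees_edge(2) increasing_trees_root_no_parent
  by blast

text \<open>\<open>V\<close> may be infinite here. Finiteness comes from the convention that an
  infinite set has \<open>card\<close> 0, whereas a nonempty child set has \<open>card\<close>
  2.\<close>

lemma increasing_trees_finite_children: "finite (children E v)"
  using increasing_trees_card_children[of v] unfolding is_leaf_def
  by (metis card.infinite finite.emptyI zero_neq_numeral)

text \<open>Labels drop from child to parent, so climbing from any vertex must stop, and the root is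
  the only vertex without a parent. This supplies the reachability clause of
  \<open>rooted_tree\<close>.\<close>

lemma increasing_trees_reachable: "v \<in> V \<Longrightarrow> (1, v) \<in> E\<^sup>*"
proof (induction v rule: less_induct)
  case (less v)
  show ?case
  proof (cases "v = 1")
    case False
    then obtain u where "(u, v) \<in> E" using increasing_trees_parent less.prems by blast
    then show ?thesis using less.IH increasing_trees_edge by (meson rtrancl.rtrancl_into_rtrancl)
  qed simp
qed

end

lemma ordered_binary_trees_eq_increasing_trees:
  assumes "N \<ge> 1"
  shows "ordered_binary_trees N = increasing_trees {1..N}"
proof (intro subset_antisym subsetI)
  fix E assume "E \<in> ordered_binary_trees N"
  then show "E \<in> increasing_trees {1..N}"
    unfolding ordered_binary_trees_def rooted_tree_def increasing_trees_def by blast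
next
  fix E assume E: "E \<in> increasing_trees {1..N}"
  then have "\<forall>v \<in> {1..N}. (1, v) \<in> E\<^sup>*" using increasing_trees_reachable by blast
  with E show "E \<in> ordered_binary_trees N"
    unfolding ordered_binary_trees_def rooted_tree_def increasing_trees_def by blast
qed

section \<open>The end of the minimal chain\<close>

lemma eoc_eqI:
  assumes "(1, l) \<in> (min_chain_step E)\<^sup>*" "is_leaf E l"
  shows "eoc E = l"
  unfolding eoc_def
proof (rule the_equality)
  fix l' assume l': "(1, l') \<in> (min_chain_step E)\<^sup>* \<and> is_leaf E l'"
  \<comment> \<open>The chain is deterministic, so two vertices reached from the root are comparable
    along it. A leaf has no further step, so two reached leaves coincide.\<close>
  have "single_valued (min_chain_step E)"
    by (auto simp: single_valued_def min_chain_step_def)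
  then have "(l, l') \<in> (min_chain_step E)\<^sup>* \<or> (l', l) \<in> (min_chain_step E)\<^sup>*"
    using assms l' single_valued_confluent by fast
  moreover have "x = y" if "(x, y) \<in> (min_chain_step E)\<^sup>*" "is_leaf E x" for x y
    using that by (cases rule: converse_rtranclE) (auto simp: min_chain_step_def)
  ultimately show "l' = l" using assms l' by metis
qed (use assms in blast)

lemma min_chain_step_in_edges:
  assumes "E \<in> increasing_trees V" "(u, v) \<in> min_chain_step E"
  shows "(u, v) \<in> E"
proof -
  have "Min (children E u) \<in> children E u"
    using assms increasing_trees_finite_children[OF assms(1), of u]
    by (intro Min_in) (auto simp: min_chain_step_def is_leaf_def)
  then show ?thesis using assms(2) by (auto simp: min_chain_step_def children_def)
qed

lemma eoc_properties:
  assumes E: "E \<in> increasing_trees V" and "finite V"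
  shows "(1, eoc E) \<in> (min_chain_step E)\<^sup>*" "is_leaf E (eoc E)" "eoc E \<in> V"
proof -
  have "\<exists>l. (v, l) \<in> (min_chain_step E)\<^sup>* \<and> is_leaf E l" for v
  \<comment> \<open>Labels grow along the chain but stay at most \<open>Max V\<close>, so this
    distance falls at each step.\<close>
  proof (induction "Max V - v" arbitrary: v rule: less_induct)
    case less
    show ?case
    proof (cases "is_leaf E v")
      case False
      then have step: "(v, Min (children E v)) \<in> min_chain_step E"
        by (auto simp: min_chain_step_def)
      then have "(v, Min (children E v)) \<in> E" using E min_chain_step_in_edges by blast
      then have "v < Min (children E v)" "Min (children E v) \<in> V"
        using increasing_trees_edge[OF E] by blast+
      moreover from this have "Min (children E v) \<le> Max V" using \<open>finite V\<close> by simp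
      ultimately have "Max V - Min (children E v) < Max V - v" by linarith
      then show ?thesis using less step by (meson converse_rtrancl_into_rtrancl)
    qed blast
  qed
  then show *: "(1, eoc E) \<in> (min_chain_step E)\<^sup>*" and "is_leaf E (eoc E)"
    using eoc_eqI by metis+
  from * show "eoc E \<in> V"
    by (cases rule: rtranclE)
      (use increasing_trees_root[OF E] increasing_trees_edge(2)[OF E]
        min_chain_step_in_edges[OF E] in auto)
qed

text \<open>The chain enters its last vertex as the smaller of two children. If the chain ends at
  one of the largest labels, this leaves very few candidates for the sibling.\<close>

lemma eoc_sibling:
  assumes E: "E \<in> increasing_trees V" and "finite V" and "eoc E \<noteq> 1"
  obtains p s where "children E p = {eoc E, s}" "eoc E < s"
proof -
  from eoc_properties(1)[OF assms(1,2)] assms(3) obtain p where p: "(p, eoc E) \<in> min_chain_step E"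
    by (auto elim: rtranclE)
  then have "card (children E p) = 2" and min: "eoc E = Min (children E p)"
    using increasing_trees_card_children[OF E] by (auto simp: min_chain_step_def)
  moreover have "eoc E \<in> children E p"
    using p min_chain_step_in_edges[OF E] by (auto simp: children_def)
  ultimately obtain s where s: "children E p = {eoc E, s}" "s \<noteq> eoc E"
    by (metis card_2_iff doubleton_eq_iff insert_iff singletonD)
  then have "eoc E < s"
    using min by (metis Min_le finite.emptyI finite.insertI insertI1 insertI2 le_neq_implies_less)
  with s show thesis using that by blast
qed

section \<open>Grafting and pruning a pair of sibling leaves\<close>

definition graft :: "nat \<Rightarrow> nat \<Rightarrow> nat \<Rightarrow> (nat \<times> nat) set \<Rightarrow> (nat \<times> nat) set" where
  "graft a b l E = E \<union> {(l, a), (l, b)}"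

text \<open>Edges out of \<open>a\<close> and \<open>b\<close> survive, so the lemmas about the
  pruned tree assume that both are leaves.\<close>

definition prune :: "nat \<Rightarrow> nat \<Rightarrow> (nat \<times> nat) set \<Rightarrow> (nat \<times> nat) set" where
  "prune a b E = {(u, v) \<in> E. v \<noteq> a \<and> v \<noteq> b}"

lemma children_graft:
  "children (graft a b l E) v = (if v = l then children E l \<union> {a, b} else children E v)"
  by (auto simp: children_def graft_def)

lemma prune_graft:
  assumes "E \<in> increasing_trees V" "a \<notin> V" "b \<notin> V"
  shows "prune a b (graft a b l E) = E"
  using increasing_trees_edge[OF assms(1)] assms(2,3) by (auto simp: prune_def graft_def)

text \<open>Parents are unique, so pruning deletes exactly the two edges from \<open>l\<close>, and
  grafting restores them.\<close>

lemma graft_prune: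
  assumes "E \<in> increasing_trees V" "children E l = {a, b}"
  shows "graft a b l (prune a b E) = E"
proof -
  have "(l, a) \<in> E" "(l, b) \<in> E" using assms(2) by (auto simp: children_def)
  then show ?thesis
    using increasing_trees_parent_unique[OF assms(1)] by (auto simp: prune_def graft_def)
qed

lemma graft_in_increasing_trees:
  assumes E: "E \<in> increasing_trees V" and l: "l \<in> V" "is_leaf E l" "l < a"
    and ab: "a < b" "a \<notin> V" "b \<notin> V"
  shows "graft a b l E \<in> increasing_trees (V \<union> {a, b})"
proof (rule increasing_treesI)
  note [dest] = increasing_trees_edge[OF E]
  show "1 \<in> V \<union> {a, b}" using increasing_trees_root[OF E] by blast
  show "graft a b l E \<subseteq> (V \<union> {a, b}) \<times> (V \<union> {a, b})"
    using l by (auto simp: graft_def)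
  show "(u, 1) \<notin> graft a b l E" for u
    using increasing_trees_root_no_parent[OF E] increasing_trees_root[OF E] ab
    by (auto simp: graft_def)
  show "\<exists>!u. (u, v) \<in> graft a b l E" if "v \<in> V \<union> {a, b}" "v \<noteq> 1" for v
  proof (cases "v \<in> V")
    case True
    then have "(u, v) \<in> graft a b l E \<longleftrightarrow> (u, v) \<in> E" for u
      using ab by (auto simp: graft_def)
    then show ?thesis using increasing_trees_parent[OF E True \<open>v \<noteq> 1\<close>] by simp
  next
    case False
    then have "(u, v) \<in> graft a b l E \<longleftrightarrow> u = l" for u
      using that by (auto simp: graft_def)
    then show ?thesis by simp
  qed
  show "card (children (graft a b l E) v) = 2" if "\<not> is_leaf (graft a b l E) v" for v
    using that l ab increasing_trees_card_children[OF E, of v]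
    by (auto simp: children_graft is_leaf_def split: if_splits)
  show "u < v" if "(u, v) \<in> graft a b l E" for u v
    using that l ab by (auto simp: graft_def)
qed

lemma prune_in_increasing_trees:
  assumes E: "E \<in> increasing_trees V" and l: "children E l = {a, b}"
    and leaf: "is_leaf E a" "is_leaf E b"
  shows "prune a b E \<in> increasing_trees (V - {a, b})"
    and "l \<in> V - {a, b}" and "is_leaf (prune a b E) l"
proof -
  note [dest] = increasing_trees_edge[OF E]
  have edges: "(l, a) \<in> E" "(l, b) \<in> E" using l by (auto simp: children_def)
  then show "l \<in> V - {a, b}" by auto
  show "is_leaf (prune a b E) l"
    using l by (auto simp: is_leaf_def prune_def children_def)
  show "prune a b E \<in> increasing_trees (V - {a, b})"
  proof (rule increasing_treesI)
    show "1 \<in> V - {a, b}"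
      using edges increasing_trees_root[OF E] increasing_trees_root_no_parent[OF E] by blast
    show "prune a b E \<subseteq> (V - {a, b}) \<times> (V - {a, b})"
      using leaf by (auto simp: prune_def is_leaf_def children_def)
    show "(u, 1) \<notin> prune a b E" for u
      using increasing_trees_root_no_parent[OF E] by (auto simp: prune_def)
    show "\<exists>!u. (u, v) \<in> prune a b E" if "v \<in> V - {a, b}" "v \<noteq> 1" for v
      using increasing_trees_parent[OF E, of v] that by (auto simp: prune_def)
    show "card (children (prune a b E) v) = 2"
      if "v \<in> V - {a, b}" "\<not> is_leaf (prune a b E) v" for v
    proof -
      \<comment> \<open>Pruning turns \<open>l\<close> into a leaf. Every other vertex keeps all its
        children, because \<open>a\<close> and \<open>b\<close> have \<open>l\<close> as their only
        parent.\<close>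
      have "v \<noteq> l" using that l by (auto simp: is_leaf_def prune_def children_def)
      then have "children (prune a b E) v = children E v"
        using edges increasing_trees_parent_unique[OF E] by (auto simp: prune_def children_def)
      then show ?thesis using that increasing_trees_card_children[OF E] by (simp add: is_leaf_def)
    qed
    show "u < v" if "(u, v) \<in> prune a b E" for u v
      using that by (auto simp: prune_def)
  qed
qed

text \<open>Grafting adds the single step \<open>(l, a)\<close> to the chain relation. The old chain
  survives; it is prolonged by \<open>a\<close> if it ended at \<open>l\<close>, and otherwise its
  end is still a leaf.\<close>

lemma eoc_graft:
  assumes E: "E \<in> increasing_trees V" "finite V" and l: "l \<in> V" "is_leaf E l"
    and ab: "a < b" "a \<notin> V" "b \<notin> V"
  shows "eoc (graft a b l E) = (if eoc E = l then a else eoc E)"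
proof -
  let ?G = "graft a b l E"
  have "Min {a, b} = a" using ab by (simp add: min_def)
  then have step: "min_chain_step ?G = insert (l, a) (min_chain_step E)"
    using l by (auto simp: min_chain_step_def is_leaf_def children_graft)
  then have path: "(1, eoc E) \<in> (min_chain_step ?G)\<^sup>*"
    using eoc_properties(1)[OF E] rtrancl_mono[of "min_chain_step E" "min_chain_step ?G"] by blast
  show ?thesis
  proof (cases "eoc E = l")
    case True
    with path step have "(1, a) \<in> (min_chain_step ?G)\<^sup>*"
      by (metis insertI1 rtrancl.rtrancl_into_rtrancl)
    moreover have "is_leaf ?G a"
      using l ab increasing_trees_edge(1)[OF E(1)]
      by (auto simp: is_leaf_def children_graft) (auto simp: children_def)
    ultimately show ?thesis using True by (simp add: eoc_eqI)
  next
    case False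
    then have "is_leaf ?G (eoc E)"
      using eoc_properties(2)[OF E] by (simp add: is_leaf_def children_graft)
    then show ?thesis using False path by (simp add: eoc_eqI)
  qed
qed

text \<open>Common frame of the counting lemmas. \<open>F E\<close> selects the leaf of the small
  tree that receives the pair; it may be constant or depend on the tree. The inverse map is
  \<open>prune a b\<close>, so each use reduces to describing membership in \<open>T\<close> through
  the pruned tree.\<close>

lemma bij_betw_graft:
  assumes ab: "a < b" "a \<in> W" "b \<in> W"
    and S: "S \<subseteq> increasing_trees (W - {a, b})"
      "\<And>E. E \<in> S \<Longrightarrow> F E \<in> W - {a, b} \<and> is_leaf E (F E) \<and> F E < a"
    and T: "\<And>E. E \<in> T \<longleftrightarrow> E \<in> increasing_trees W \<and> is_leaf E a \<and> is_leaf E b \<and>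
      prune a b E \<in> S \<and> children E (F (prune a b E)) = {a, b}"
  shows "bij_betw (\<lambda>E. graft a b (F E) E) S T"
proof (rule bij_betw_byWitness[where f' = "prune a b"])
  have *: "prune a b (graft a b (F E) E) = E" if "E \<in> S" for E
    using that S by (intro prune_graft) auto
  then show "\<forall>E\<in>S. prune a b (graft a b (F E) E) = E" by blast
  show "\<forall>E\<in>T. graft a b (F (prune a b E)) (prune a b E) = E"
    using T graft_prune by blast
  show "prune a b ` T \<subseteq> S" using T by blast
  show "(\<lambda>E. graft a b (F E) E) ` S \<subseteq> T"
  proof safe
    fix E assume "E \<in> S"
    have E: "E \<in> increasing_trees (W - {a, b})" using S \<open>E \<in> S\<close> by blast
    have F: "F E \<in> W - {a, b}" "is_leaf E (F E)" "F E < a" using S \<open>E \<in> S\<close> by blast+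
    have "W - {a, b} \<union> {a, b} = W" using ab by blast
    then have "graft a b (F E) E \<in> increasing_trees W"
      using graft_in_increasing_trees[OF E F ab(1)] by simp
    moreover have "is_leaf (graft a b (F E) E) a" "is_leaf (graft a b (F E) E) b"
      using F increasing_trees_edge(1)[OF E]
      by (auto simp: is_leaf_def children_graft) (auto simp: children_def)
    moreover have "children (graft a b (F E) E) (F E) = {a, b}"
      using F by (simp add: children_graft is_leaf_def)
    ultimately show "graft a b (F E) E \<in> T"
      unfolding T using * \<open>E \<in> S\<close> by simp
  qed
qed

text \<open>This is \<open>eoc_graft\<close> applied to the pruned tree, since
  \<open>graft_prune\<close> recovers \<open>E\<close> from it.\<close>

lemma eoc_prune:
  assumes E: "E \<in> increasing_trees V" "finite V" and l: "children E l = {a, b}"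
    and leaf: "is_leaf E a" "is_leaf E b" and "a < b"
  shows "eoc E = (if eoc (prune a b E) = l then a else eoc (prune a b E))"
  using eoc_graft[of "prune a b E" "V - {a, b}" l a b] prune_in_increasing_trees[OF E(1) l leaf]
    graft_prune[OF E(1) l] assms
  by simp

text \<open>The label \<open>a\<close> is absent from the pruned tree. Hence a chain ending at
  \<open>a\<close> must be a chain of the pruned tree that ended at \<open>k\<close> and was
  prolonged.\<close>

lemma card_graft_at_eoc:
  assumes "finite W" "a < b" "a \<in> W" "b \<in> W" "k < a"
  shows "card {E \<in> increasing_trees W.
           is_leaf E a \<and> is_leaf E b \<and> children E k = {a, b} \<and> eoc E = a} =
         card {E \<in> increasing_trees (W - {a, b}). eoc E = k}" (is "card ?T = card ?S")
proof -
  have "bij_betw (\<lambda>E. graft a b k E) ?S ?T"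
  proof (rule bij_betw_graft)
    show "k \<in> W - {a, b} \<and> is_leaf E k \<and> k < a" if "E \<in> ?S" for E
      using that eoc_properties[of E "W - {a, b}"] assms by blast
    show "E \<in> ?T \<longleftrightarrow> E \<in> increasing_trees W \<and> is_leaf E a \<and> is_leaf E b \<and>
      prune a b E \<in> ?S \<and> children E k = {a, b}" for E
    proof (cases "E \<in> increasing_trees W \<and> is_leaf E a \<and> is_leaf E b \<and> children E k = {a, b}")
      case True
      then have pr: "prune a b E \<in> increasing_trees (W - {a, b})"
        using prune_in_increasing_trees by blast
      then have "eoc (prune a b E) \<noteq> a" using eoc_properties(3) assms(1) by blast
      moreover have "eoc E = (if eoc (prune a b E) = k then a else eoc (prune a b E))"
        using True assms by (intro eoc_prune) auto
      ultimately show ?thesis using True pr by auto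
    qed blast
  qed (use assms in auto)
  then show ?thesis by (simp add: bij_betw_same_card)
qed

text \<open>As \<open>m\<close> differs from \<open>l\<close> and \<open>a\<close>, the chain end is
  \<open>m\<close> before grafting exactly when it is \<open>m\<close> afterwards; \<open>l\<close>
  can then be any leaf other than the chain end.\<close>

lemma card_graft_off_eoc:
  assumes "finite W" "a < b" "a \<in> W" "b \<in> W" "l \<in> W" "l < a" "m \<noteq> l" "m \<noteq> a"
  shows "card {E \<in> increasing_trees W.
           is_leaf E a \<and> is_leaf E b \<and> children E l = {a, b} \<and> eoc E = m} =
         card {E \<in> increasing_trees (W - {a, b}). is_leaf E l \<and> eoc E = m}"
    (is "card ?T = card ?S")
proof -
  have "bij_betw (\<lambda>E. graft a b l E) ?S ?T"
  proof (rule bij_betw_graft)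
    show "E \<in> ?T \<longleftrightarrow> E \<in> increasing_trees W \<and> is_leaf E a \<and> is_leaf E b \<and>
      prune a b E \<in> ?S \<and> children E l = {a, b}" for E
    proof (cases "E \<in> increasing_trees W \<and> is_leaf E a \<and> is_leaf E b \<and> children E l = {a, b}")
      case True
      then have "prune a b E \<in> increasing_trees (W - {a, b})" "is_leaf (prune a b E) l"
        using prune_in_increasing_trees by blast+
      moreover have "eoc E = (if eoc (prune a b E) = l then a else eoc (prune a b E))"
        using True assms by (intro eoc_prune) auto
      ultimately show ?thesis using True assms by auto
    qed blast
  qed (use assms in auto)
  then show ?thesis by (simp add: bij_betw_same_card)
qed

text \<open>Here the receiving leaf varies with the tree: the pair hangs from the chain end itself.
  The chain end of the small tree is thus unconstrained, and only the parent of \<open>c\<close> is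
  recorded, which yields a column marginal. \<open>W\<close> may contain labels above
  \<open>a\<close>, so \<open>less\<close> ensures that the grafted edges increase.\<close>

lemma card_graft_at_own_eoc:
  assumes "finite W" "a < b" "a \<in> W" "b \<in> W" "c \<noteq> a" "c \<noteq> b"
    and less: "\<And>E. E \<in> increasing_trees (W - {a, b}) \<Longrightarrow> eoc E < a"
  shows "card {E \<in> increasing_trees W.
           is_leaf E a \<and> is_leaf E b \<and> (\<exists>l. children E l = {a, b}) \<and> eoc E = a \<and> (k, c) \<in> E} =
         card {E \<in> increasing_trees (W - {a, b}). (k, c) \<in> E}" (is "card ?T = card ?S")
proof -
  have "bij_betw (\<lambda>E. graft a b (eoc E) E) ?S ?T"
  proof (rule bij_betw_graft)
    show "eoc E \<in> W - {a, b} \<and> is_leaf E (eoc E) \<and> eoc E < a" if "E \<in> ?S" for E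
      using that eoc_properties[of E "W - {a, b}"] assms by blast
    show "E \<in> ?T \<longleftrightarrow> E \<in> increasing_trees W \<and> is_leaf E a \<and> is_leaf E b \<and>
      prune a b E \<in> ?S \<and> children E (eoc (prune a b E)) = {a, b}" for E
    proof (cases "\<exists>l. E \<in> increasing_trees W \<and> is_leaf E a \<and> is_leaf E b \<and> children E l = {a, b}")
      case True
      then obtain l where l: "E \<in> increasing_trees W" "children E l = {a, b}"
        "is_leaf E a" "is_leaf E b" by blast
      then have pr: "prune a b E \<in> increasing_trees (W - {a, b})"
        using prune_in_increasing_trees by blast
      then have "eoc (prune a b E) \<noteq> a" using less by fastforce
      moreover have "eoc E = (if eoc (prune a b E) = l then a else eoc (prune a b E))"
        using l assms by (intro eoc_prune) auto
      \<comment> \<open>Only one vertex can have this child set, so the existential in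
        \<open>?T\<close> and the condition at \<open>eoc (prune a b E)\<close> speak of the same
        vertex.\<close>
      moreover have "children E l' = {a, b} \<longleftrightarrow> l' = l" for l'
        using l(2) increasing_trees_parent_unique[OF l(1), of l a l']
        unfolding children_def by blast
      moreover have "(k, c) \<in> prune a b E \<longleftrightarrow> (k, c) \<in> E" using assms by (simp add: prune_def)
      ultimately show ?thesis using l pr by simp
    qed blast
  qed (use assms in auto)
  then show ?thesis by (simp add: bij_betw_same_card)
qed

text \<open>A chain end other than the root has a larger sibling, so it cannot be the maximal
  label.\<close>

lemma eoc_less_Max:
  assumes "E \<in> increasing_trees V" "finite V" "v \<in> V" "v \<noteq> 1" "\<And>u. u \<in> V \<Longrightarrow> u \<le> v"
  shows "eoc E < v"
proof (rule ccontr)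
  assume "\<not> eoc E < v"
  then have "eoc E = v" using eoc_properties(3)[OF assms(1,2)] assms(5) by fastforce
  then obtain p s where "children E p = {v, s}" "v < s"
    using eoc_sibling[OF assms(1,2)] assms(4) by metis
  then have "s \<in> V" using increasing_trees_edge(2)[OF assms(1), of p s] by (auto simp: children_def)
  then show False using \<open>v < s\<close> assms(5) by fastforce
qed

section \<open>Order-preserving changes of labels\<close>

definition relabel :: "(nat \<Rightarrow> nat) \<Rightarrow> (nat \<times> nat) set \<Rightarrow> (nat \<times> nat) set" where
  "relabel f E = map_prod f f ` E"

context
  fixes V E and f :: "nat \<Rightarrow> nat"
  assumes E: "E \<in> increasing_trees V" and f: "strict_mono_on V f" "f 1 = 1"
begin

lemma relabel_iff:
  assumes "u \<in> V" "v \<in> V"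
  shows "(f u, f v) \<in> relabel f E \<longleftrightarrow> (u, v) \<in> E"
proof
  assume "(f u, f v) \<in> relabel f E"
  then obtain u' v' where uv': "(u', v') \<in> E" "f u = f u'" "f v = f v'"
    unfolding relabel_def by auto
  then have "u' \<in> V" "v' \<in> V" using increasing_trees_edge[OF E] by blast+
  then have "u = u'" "v = v'"
    using inj_onD[OF strict_mono_on_imp_inj_on[OF f(1)]] uv' assms by blast+
  with uv' show "(u, v) \<in> E" by simp
next
  assume "(u, v) \<in> E"
  then show "(f u, f v) \<in> relabel f E" unfolding relabel_def by (rule rev_image_eqI) simp
qed

lemma children_relabel:
  assumes "v \<in> V"
  shows "children (relabel f E) (f v) = f ` children E v"
proof (intro subset_antisym subsetI)
  fix y assume "y \<in> children (relabel f E) (f v)"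
  then have y: "(f v, y) \<in> relabel f E" by (simp add: children_def)
  then obtain w where w: "y = f w" "w \<in> V"
    unfolding relabel_def using increasing_trees_edge(2)[OF E] by auto
  then have "(v, w) \<in> E" using y relabel_iff[OF assms] by blast
  with w show "y \<in> f ` children E v" by (simp add: children_def)
next
  fix y assume "y \<in> f ` children E v"
  then obtain w where w: "y = f w" "(v, w) \<in> E" by (auto simp: children_def)
  then show "y \<in> children (relabel f E) (f v)"
    using relabel_iff[OF assms] increasing_trees_edge(2)[OF E] by (simp add: children_def)
qed

lemma is_leaf_relabel: "v \<in> V \<Longrightarrow> is_leaf (relabel f E) (f v) \<longleftrightarrow> is_leaf E v"
  by (simp add: is_leaf_def children_relabel)

lemma relabel_in_increasing_trees: "relabel f E \<in> increasing_trees (f ` V)"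
proof (rule increasing_treesI)
  note inj = strict_mono_on_imp_inj_on[OF f(1)]
  show "1 \<in> f ` V" using increasing_trees_root[OF E] f(2) by force
  show sub: "relabel f E \<subseteq> f ` V \<times> f ` V"
    using increasing_trees_edge[OF E] by (auto simp: relabel_def)
  show "(u, 1) \<notin> relabel f E" for u
  proof
    assume u: "(u, 1) \<in> relabel f E"
    then obtain u' where "u' \<in> V" "u = f u'" using sub by blast
    then have "(u', 1) \<in> E" using u relabel_iff[of u' 1] increasing_trees_root[OF E] f(2) by simp
    then show False using increasing_trees_root_no_parent[OF E] by blast
  qed
  show "\<exists>!u. (u, v) \<in> relabel f E" if v: "v \<in> f ` V" "v \<noteq> 1" for v
  proof -
    obtain w where w: "w \<in> V" "v = f w" "w \<noteq> 1" using v f(2) by blast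
    then obtain u where u: "(u, w) \<in> E" using increasing_trees_parent[OF E] by blast
    show ?thesis
    proof
      show "(f u, v) \<in> relabel f E" using u w by (force simp: relabel_def)
      fix x assume x: "(x, v) \<in> relabel f E"
      then obtain x' where "x' \<in> V" "x = f x'" using sub by blast
      then show "x = f u" using x w u relabel_iff increasing_trees_parent_unique[OF E] by metis
    qed
  qed
  show "card (children (relabel f E) v) = 2"
    if v: "v \<in> f ` V" "\<not> is_leaf (relabel f E) v" for v
  proof -
    obtain w where w: "w \<in> V" "v = f w" using v by blast
    have "inj_on f (children E w)"
      using increasing_trees_edge(2)[OF E] by (intro inj_on_subset[OF inj]) (auto simp: children_def)
    then show ?thesis
      using v w increasing_trees_card_children[OF E, of w]
      by (simp add: children_relabel is_leaf_relabel card_image)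
  qed
  show "u < v" if "(u, v) \<in> relabel f E" for u v
    using that increasing_trees_edge[OF E] strict_mono_onD[OF f(1)] by (auto simp: relabel_def)
qed

text \<open>A strictly increasing map commutes with choosing the smaller child, so it carries the
  chain over step by step; \<open>f 1 = 1\<close> preserves its start.\<close>

lemma eoc_relabel:
  assumes "finite V"
  shows "eoc (relabel f E) = f (eoc E)"
proof (rule eoc_eqI)
  have step: "(f u, f v) \<in> min_chain_step (relabel f E)" if uv: "(u, v) \<in> min_chain_step E" for u v
  proof -
    have "(u, v) \<in> E" using uv min_chain_step_in_edges[OF E] by blast
    then have "u \<in> V" using increasing_trees_edge[OF E] by blast
    have "Min (f ` children E u) = f v"
    proof (rule Min_eqI)
      show "finite (f ` children E u)" using increasing_trees_finite_children[OF E] by simp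
      show "f v \<in> f ` children E u" using \<open>(u, v) \<in> E\<close> by (simp add: children_def)
      fix y assume "y \<in> f ` children E u"
      then obtain w where w: "w \<in> children E u" "y = f w" by blast
      then have "v \<le> w" using uv increasing_trees_finite_children[OF E]
        by (auto simp: min_chain_step_def)
      moreover have "v \<in> V" "w \<in> V" using w \<open>(u, v) \<in> E\<close> increasing_trees_edge[OF E]
        by (auto simp: children_def)
      ultimately show "f v \<le> y" using w f(1) strict_mono_on_leD by blast
    qed
    moreover have "\<not> is_leaf (relabel f E) (f u)"
      using uv \<open>u \<in> V\<close> by (auto simp: is_leaf_relabel min_chain_step_def)
    ultimately show ?thesis using \<open>u \<in> V\<close> by (force simp: min_chain_step_def children_relabel)
  qed
  have "(f 1, f v) \<in> (min_chain_step (relabel f E))\<^sup>*" if "(1, v) \<in> (min_chain_step E)\<^sup>*" for v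
    using that by induction (auto intro: step rtrancl_into_rtrancl)
  then show "(1, f (eoc E)) \<in> (min_chain_step (relabel f E))\<^sup>*"
    using eoc_properties(1)[OF E assms] f(2) by metis
  show "is_leaf (relabel f E) (f (eoc E))"
    using eoc_properties[OF E assms] by (simp add: is_leaf_relabel)
qed

end

text \<open>The inverse of a strictly increasing map is strictly increasing on the image, so
  relabelling by it stays within increasing trees and undoes the first relabelling.\<close>

lemma bij_betw_relabel:
  assumes f: "strict_mono_on V f" "f 1 = 1" and "1 \<in> V"
  shows "bij_betw (relabel f) (increasing_trees V) (increasing_trees (f ` V))"
proof (rule bij_betw_byWitness[where f' = "relabel (inv_into V f)"])
  let ?h = "inv_into V f"
  note inj = strict_mono_on_imp_inj_on[OF f(1)]
  have h: "strict_mono_on (f ` V) ?h"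
    using strict_mono_on_less[OF f(1)] inj by (auto intro!: strict_mono_onI)
  have h1: "?h 1 = 1" using inv_into_f_f[OF inj \<open>1 \<in> V\<close>] f(2) by simp
  have hV: "?h ` f ` V = V" using inj by (auto simp: image_image)
  have id: "relabel q (relabel p E) = E"
    if "E \<in> increasing_trees U" "\<And>x. x \<in> U \<Longrightarrow> q (p x) = x" for E p q U
  proof -
    have "map_prod q q (map_prod p p e) = e" if "e \<in> E" for e
      using that \<open>E \<in> increasing_trees U\<close> \<open>\<And>x. x \<in> U \<Longrightarrow> q (p x) = x\<close>
      by (cases e) (auto dest: increasing_trees_edge)
    then show ?thesis by (simp add: relabel_def image_image)
  qed
  show "\<forall>E\<in>increasing_trees V. relabel ?h (relabel f E) = E"
    using id[of _ V ?h f] inj by simp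
  show "\<forall>E\<in>increasing_trees (f ` V). relabel f (relabel ?h E) = E"
    using id[of _ "f ` V" f ?h] by (simp add: f_inv_into_f)
  show "relabel f ` increasing_trees V \<subseteq> increasing_trees (f ` V)"
    using relabel_in_increasing_trees[OF _ f] by blast
  show "relabel ?h ` increasing_trees (f ` V) \<subseteq> increasing_trees V"
    using relabel_in_increasing_trees[OF _ h h1] hV by auto
qed

context
  fixes N M :: nat
  assumes NM: "2 \<le> N" "N \<le> M"
begin

text \<open>Pruning can leave a gap just below the largest label. Moving that label between
  \<open>N\<close> and \<open>M\<close> fixes all smaller labels, so conditions involving only some
  \<open>k < N\<close> and the maximum keep their counts.\<close>

lemma card_eoc_raise_Max:
  assumes "k < N"
  shows "card {E \<in> increasing_trees ({1..<N} \<union> {M}). eoc E = k} =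
         card {E \<in> increasing_trees {1..N}. eoc E = k}" (is "card ?T = card ?S")
  and card_parent_raise_Max:
  "card {E \<in> increasing_trees ({1..<N} \<union> {M}). (k, M) \<in> E} =
         card {E \<in> increasing_trees {1..N}. (k, N) \<in> E}" (is "card ?T' = card ?S'")
proof -
  define f where "f x = (if x = N then M else x)" for x
  have f: "strict_mono_on {1..N} f" "f 1 = 1"
    using NM by (auto simp: f_def intro!: strict_mono_onI)
  have "{1..N} = {1..<N} \<union> {N}" using NM by auto
  then have V: "f ` {1..N} = {1..<N} \<union> {M}" by (auto simp: f_def)
  have bij: "bij_betw (relabel f) (increasing_trees {1..N}) (increasing_trees ({1..<N} \<union> {M}))"
    using bij_betw_relabel[OF f] V NM by simp
  have restrict: "card {E \<in> increasing_trees ({1..<N} \<union> {M}). Q E} =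
      card {E \<in> increasing_trees {1..N}. P E}"
    if "\<And>E. E \<in> increasing_trees {1..N} \<Longrightarrow> Q (relabel f E) \<longleftrightarrow> P E" for P Q
  proof -
    have "relabel f ` {E \<in> increasing_trees {1..N}. P E} =
        {E \<in> increasing_trees ({1..<N} \<union> {M}). Q E}"
      unfolding bij_betw_imp_surj_on[OF bij, symmetric] using that by blast
    moreover have "inj_on (relabel f) {E \<in> increasing_trees {1..N}. P E}"
      by (rule inj_on_subset[OF bij_betw_imp_inj_on[OF bij]]) blast
    ultimately show ?thesis using card_image by fastforce
  qed
  show "card ?T = card ?S"
  proof (rule restrict)
    fix E assume "E \<in> increasing_trees {1..N}"
    then have "eoc (relabel f E) = f (eoc E)" by (rule eoc_relabel[OF _ f]) simp
    then show "eoc (relabel f E) = k \<longleftrightarrow> eoc E = k"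
      using assms NM unfolding f_def[of "eoc E"] by auto
  qed
  show "card ?T' = card ?S'"
  proof (rule restrict)
    fix E assume E: "E \<in> increasing_trees {1..N}"
    have "(f k, f N) \<in> relabel f E \<longleftrightarrow> (k, N) \<in> E" if "k \<in> {1..N}"
      using that NM by (intro relabel_iff[OF E f]) auto
    moreover have "k \<in> {1..N}" if "(k, N) \<in> E" using that increasing_trees_edge[OF E] by blast
    \<comment> \<open>The relabelled vertices are \<open>{1..<N}\<close> and \<open>M\<close>; as
      \<open>k < N \<le> M\<close>, the label \<open>k\<close> lies in the first part.\<close>
    moreover have "k \<in> {1..N}" if "(k, M) \<in> relabel f E"
    proof -
      have "k \<in> f ` {1..N}"
        using increasing_trees_edge(1)[OF relabel_in_increasing_trees[OF E f] that] .
      then show ?thesis unfolding V using NM assms by auto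
    qed
    ultimately show "(k, M) \<in> relabel f E \<longleftrightarrow> (k, N) \<in> E"
      using assms f_def[of k] f_def[of N] by auto
  qed
qed

end

section \<open>The numbers \<open>g\<close> and their marginals as counts of increasing
  trees\<close>

lemma Sum_any_card_fibers:
  assumes "finite A"
  shows "Sum_any (\<lambda>k. card {x \<in> A. f x = k}) = card A"
proof -
  \<comment> \<open>Fibers over values outside the image of \<open>A\<close> are empty, so the
    support is finite; the remaining fibers partition \<open>A\<close>.\<close>
  have "Sum_any (\<lambda>k. card {x \<in> A. f x = k}) = (\<Sum>k\<in>f ` A. card {x \<in> A. f x = k})"
    by (rule Sum_any.expand_superset) (use assms in \<open>auto simp: card_eq_0_iff\<close>)
  also have "\<dots> = card A"
    using sum.image_gen[OF assms, of "\<lambda>_. 1 :: nat" f] by simp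
  finally show ?thesis .
qed

context
  fixes n :: nat
  assumes n: "n \<ge> 1"
begin

lemma finite_increasing_trees: "finite (increasing_trees {1..2 * n + 1})"
  using finite_ordered_binary_trees[of "2 * n + 1"]
  by (simp add: ordered_binary_trees_eq_increasing_trees)

text \<open>The parent of the maximum is unique, so the definite description becomes an edge
  condition, which grafting and relabelling handle directly.\<close>

lemma pom_eq_iff:
  assumes "E \<in> increasing_trees {1..2 * n + 1}"
  shows "pom n E = k \<longleftrightarrow> (k, 2 * n + 1) \<in> E"
proof -
  have "\<exists>!p. (p, 2 * n + 1) \<in> E" using increasing_trees_parent[OF assms, of "2 * n + 1"] n by simp
  then show ?thesis unfolding pom_def by (metis (no_types, lifting) theI')
qed

lemma g_eq_card:
  "g n (int m) (int k) =
     card {E \<in> increasing_trees {1..2 * n + 1}. eoc E = m \<and> (k, 2 * n + 1) \<in> E}"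
proof -
  have "{E \<in> increasing_trees {1..2 * n + 1}. eoc E = m \<and> pom n E = k} =
      {E \<in> increasing_trees {1..2 * n + 1}. eoc E = m \<and> (k, 2 * n + 1) \<in> E}"
    using pom_eq_iff by blast
  then show ?thesis unfolding g_def by (simp add: ordered_binary_trees_eq_increasing_trees)
qed

lemma g_row_eq_card: "g_row n (int m) = card {E \<in> increasing_trees {1..2 * n + 1}. eoc E = m}"
  using Sum_any_card_fibers[of "{E \<in> increasing_trees {1..2 * n + 1}. eoc E = m}" "\<lambda>E. int (pom n E)"]
    finite_increasing_trees
  by (simp add: g_row_def g_def ordered_binary_trees_eq_increasing_trees)

lemma g_col_eq_card:
  "g_col n (int k) = card {E \<in> increasing_trees {1..2 * n + 1}. (k, 2 * n + 1) \<in> E}"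
proof -
  have "{E \<in> increasing_trees {1..2 * n + 1}. (k, 2 * n + 1) \<in> E} =
      {E \<in> increasing_trees {1..2 * n + 1}. pom n E = k}"
    using pom_eq_iff by blast
  then show ?thesis
    using Sum_any_card_fibers[of "{E \<in> increasing_trees {1..2 * n + 1}. pom n E = k}" "\<lambda>E. int (eoc E)"]
      finite_increasing_trees
    by (simp add: g_col_def g_def ordered_binary_trees_eq_increasing_trees conj_ac)
qed

end

text \<open>At most one label, namely \<open>N\<close>, exceeds \<open>v\<close>, which is too few
  for two children.\<close>

lemma is_leaf_large_label:
  assumes E: "E \<in> increasing_trees {1..N}" and "N \<le> v + 1"
  shows "is_leaf E v"
proof (rule ccontr)
  assume "\<not> is_leaf E v"
  then have "card (children E v) = 2" using increasing_trees_card_children[OF E] by blast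
  moreover have "children E v \<subseteq> {N}"
    using increasing_trees_edge[OF E] assms(2) by (fastforce simp: children_def)
  ultimately show False using card_mono[of "{N}" "children E v"] by simp
qed

lemma not_leaf_parent: "(u, v) \<in> E \<Longrightarrow> \<not> is_leaf E u"
  unfolding is_leaf_def children_def by blast

section \<open>Values of \<open>g\<close> at the large labels, where \<open>N = 2n - 1\<close> is
  the size of the smaller trees\<close>

context
  fixes n N :: nat
  assumes N: "2 * n = N + 1" "3 \<le> N"
begin

lemma g_eq_card_labels:
  "g n (int m) (int k) = card {E \<in> increasing_trees {1..N + 2}. eoc E = m \<and> (k, N + 2) \<in> E}"
  using g_eq_card[of n m k] N by simp

lemma g_row_pred_eq_card:
  "g_row (n - 1) (int m) = card {E \<in> increasing_trees {1..N}. eoc E = m}"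
proof -
  have "2 * (n - 1) + 1 = N" "n - 1 \<ge> 1" using N by linarith+
  then show ?thesis using g_row_eq_card[of "n - 1" m] by simp
qed

lemma g_col_pred_eq_card:
  "g_col (n - 1) (int k) = card {E \<in> increasing_trees {1..N}. (k, N) \<in> E}"
proof -
  have "2 * (n - 1) + 1 = N" "n - 1 \<ge> 1" using N by linarith+
  then show ?thesis using g_col_eq_card[of "n - 1" k] by simp
qed

lemma g_pom_penultimate: "g n (int m) (int (N + 1)) = 0"
proof -
  have "(N + 1, N + 2) \<notin> E" if "E \<in> increasing_trees {1..N + 2}" for E
    using is_leaf_large_label[OF that, of "N + 1"] not_leaf_parent[of "N + 1" "N + 2" E] by auto
  then have "{E \<in> increasing_trees {1..N + 2}. eoc E = m \<and> (N + 1, N + 2) \<in> E} = {}" by blast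
  then show ?thesis using g_eq_card_labels[of m "N + 1"] by (metis card.empty)
qed

text \<open>The chain end is a leaf, whereas the parent of the maximum is not.\<close>

lemma g_diagonal: "g n (int m) (int m) = 0"
proof -
  have "(eoc E, N + 2) \<notin> E" if "E \<in> increasing_trees {1..N + 2}" for E
    using eoc_properties(2)[OF that] not_leaf_parent[of "eoc E" "N + 2" E] by auto
  then have "{E \<in> increasing_trees {1..N + 2}. eoc E = m \<and> (m, N + 2) \<in> E} = {}" by blast
  then show ?thesis using g_eq_card_labels[of m m] by (metis card.empty)
qed

lemma remove_last_two: "{1..N + 2} - {N + 1, N + 2} = {1..N}"
  by auto

text \<open>Only \<open>N + 1\<close> and \<open>N + 2\<close> exceed \<open>N\<close>, so if
  \<open>N\<close> is the parent of one it is the parent of both. The count then has the shape that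
  the grafting lemmas expect.\<close>

lemma g_pom_antepenultimate:
  "g n (int m) (int N) =
    card {E \<in> increasing_trees {1..N + 2}. is_leaf E (N + 1) \<and> is_leaf E (N + 2) \<and>
      children E N = {N + 1, N + 2} \<and> eoc E = m}"
proof -
  have "children E N = {N + 1, N + 2} \<longleftrightarrow> (N, N + 2) \<in> E"
    if E: "E \<in> increasing_trees {1..N + 2}" for E
  proof
    assume "(N, N + 2) \<in> E"
    then have "card (children E N) = 2"
      by (intro increasing_trees_card_children[OF E] not_leaf_parent)
    moreover have "children E N \<subseteq> {N + 1, N + 2}"
      using increasing_trees_edge[OF E] by (fastforce simp: children_def)
    ultimately show "children E N = {N + 1, N + 2}" by (intro card_subset_eq) auto
  qed (auto simp: children_def)
  then have "{E \<in> increasing_trees {1..N + 2}. eoc E = m \<and> (N, N + 2) \<in> E} =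
    {E \<in> increasing_trees {1..N + 2}. is_leaf E (N + 1) \<and> is_leaf E (N + 2) \<and>
      children E N = {N + 1, N + 2} \<and> eoc E = m}"
    using is_leaf_large_label[of _ "N + 2"] by auto
  then show ?thesis using g_eq_card_labels by simp
qed

text \<open>After pruning the two children of \<open>N\<close>, the chain would have to end at
  \<open>N\<close>, now the maximum, which \<open>eoc_less_Max\<close> excludes.\<close>

lemma g_penultimate_antepenultimate: "g n (int (N + 1)) (int N) = 0"
proof -
  have "eoc E < N" if "E \<in> increasing_trees {1..N}" for E
    by (rule eoc_less_Max[OF that]) (use N in auto)
  then have "{E \<in> increasing_trees {1..N}. eoc E = N} = {}" by fastforce
  moreover have "g n (int (N + 1)) (int N) = card {E \<in> increasing_trees {1..N}. eoc E = N}"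
    unfolding g_pom_antepenultimate remove_last_two[symmetric]
    by (rule card_graft_at_eoc) (use N in auto)
  ultimately show ?thesis by (simp only: card.empty)
qed

text \<open>Once the children of \<open>N\<close> are pruned, \<open>N\<close> is the maximum and
  hence a leaf in every remaining tree, so the whole row is counted.\<close>

lemma g_pom_antepenultimate_eq_row:
  assumes "m < N"
  shows "g n (int m) (int N) = g_row (n - 1) (int m)"
proof -
  have "g n (int m) (int N) = card {E \<in> increasing_trees {1..N}. is_leaf E N \<and> eoc E = m}"
    unfolding g_pom_antepenultimate remove_last_two[symmetric]
    by (rule card_graft_off_eoc) (use N assms in auto)
  moreover have "{E \<in> increasing_trees {1..N}. is_leaf E N \<and> eoc E = m} =
      {E \<in> increasing_trees {1..N}. eoc E = m}"
    using is_leaf_large_label[of _ N N] by auto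
  ultimately show ?thesis using g_row_pred_eq_card by simp
qed

text \<open>The sibling of the chain end \<open>N + 1\<close> is larger, hence equals
  \<open>N + 2\<close>, and their common parent is \<open>k\<close>. Pruning the pair moves the
  chain end to \<open>k\<close>.\<close>

lemma g_eoc_penultimate:
  assumes "k < N"
  shows "g n (int (N + 1)) (int k) = g_row (n - 1) (int k)"
proof -
  let ?a = "N + 1" and ?b = "N + 2"
  have "{E \<in> increasing_trees {1..?b}. eoc E = ?a \<and> (k, ?b) \<in> E} =
    {E \<in> increasing_trees {1..?b}. is_leaf E ?a \<and> is_leaf E ?b \<and> children E k = {?a, ?b} \<and> eoc E = ?a}"
    (is "?L = ?R")
  proof (intro subset_antisym subsetI)
    fix E assume "E \<in> ?L"
    then have E: "E \<in> increasing_trees {1..?b}" "eoc E = ?a" "(k, ?b) \<in> E" by auto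
    have "?a \<noteq> 1" using N by simp
    then obtain p s where p: "children E p = {?a, s}" "?a < s"
      using eoc_sibling[OF E(1)] E(2) by (metis finite_atLeastAtMost)
    then have ps: "(p, s) \<in> E" by (auto simp: children_def)
    then have "s \<le> ?b" using increasing_trees_edge(2)[OF E(1)] by fastforce
    then have "s = ?b" using p by linarith
    moreover from this have "p = k"
      using increasing_trees_parent_unique[OF E(1)] ps E(3) by blast
    ultimately show "E \<in> ?R" using p E is_leaf_large_label[OF E(1)] by simp
  qed (auto simp: children_def)
  then have "g n (int ?a) (int k) = card ?R" unfolding g_eq_card_labels by (rule arg_cong)
  also have "\<dots> = card {E \<in> increasing_trees ({1..?b} - {?a, ?b}). eoc E = k}"
    by (rule card_graft_at_eoc) (use assms in auto)
  finally show ?thesis unfolding remove_last_two g_row_pred_eq_card .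
qed

text \<open>The sibling of the chain end \<open>N\<close> is \<open>N + 2\<close> or \<open>N + 1\<close>; these two cases
  give the two summands.\<close>

lemma g_eoc_antepenultimate:
  assumes "k < N"
  shows "g n (int N) (int k) = g_row (n - 1) (int k) + g_col (n - 1) (int k)"
proof -
  let ?a = N and ?b = "N + 1" and ?c = "N + 2"
  let ?A = "{E \<in> increasing_trees {1..?c}.
    is_leaf E ?a \<and> is_leaf E ?c \<and> children E k = {?a, ?c} \<and> eoc E = ?a}"
  let ?B = "{E \<in> increasing_trees {1..?c}. is_leaf E ?a \<and> is_leaf E ?b \<and>
    (\<exists>l. children E l = {?a, ?b}) \<and> eoc E = ?a \<and> (k, ?c) \<in> E}"
  have "{E \<in> increasing_trees {1..?c}. eoc E = ?a \<and> (k, ?c) \<in> E} = ?A \<union> ?B" (is "?L = _")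
  proof (intro subset_antisym subsetI)
    fix E assume "E \<in> ?L"
    then have E: "E \<in> increasing_trees {1..?c}" "eoc E = ?a" "(k, ?c) \<in> E" by auto
    have "?a \<noteq> 1" using N by simp
    then obtain p s where p: "children E p = {?a, s}" "?a < s"
      using eoc_sibling[OF E(1)] E(2) by (metis finite_atLeastAtMost)
    then have "(p, s) \<in> E" by (auto simp: children_def)
    then have "s \<le> ?c" using increasing_trees_edge(2)[OF E(1)] by fastforce
    then have "s = ?b \<or> s = ?c" using p by linarith
    moreover have "p = k" if "s = ?c"
      using increasing_trees_parent_unique[OF E(1), of p ?c k] E that \<open>(p, s) \<in> E\<close> by blast
    \<comment> \<open>Two labels exceed \<open>N\<close>, so it is a leaf as the chain end and not
      merely by its size.\<close>
    moreover have "is_leaf E ?a" using eoc_properties(2)[OF E(1)] E(2) by simp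
    moreover have "is_leaf E ?b" "is_leaf E ?c" by (rule is_leaf_large_label[OF E(1)], simp)+
    ultimately show "E \<in> ?A \<union> ?B" using p E by auto
  qed (auto simp: children_def)
  \<comment> \<open>The vertex \<open>N\<close> has one parent, whose child set would have to be
    both \<open>{N, N + 2}\<close> and \<open>{N, N + 1}\<close>.\<close>
  moreover have "?A \<inter> ?B = {}"
  proof -
    have False if E: "E \<in> ?A" "E \<in> ?B" for E
    proof -
      obtain l where l: "children E l = {?a, ?b}" "children E k = {?a, ?c}" using E by blast
      then have "(l, ?a) \<in> E" "(k, ?a) \<in> E" by (auto simp: children_def)
      then have "l = k" using E increasing_trees_parent_unique by blast
      with l show False by (auto simp: doubleton_eq_iff)
    qed
    then show ?thesis by blast
  qed
  moreover have "finite (increasing_trees {1..?c})"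
    using finite_increasing_trees[of n] N by simp
  ultimately have "g n (int ?a) (int k) = card ?A + card ?B"
    unfolding g_eq_card_labels by (simp add: card_Un_disjoint)
  moreover have "card ?A = g_row (n - 1) (int k)"
  proof -
    have "card ?A = card {E \<in> increasing_trees ({1..?c} - {?a, ?c}). eoc E = k}"
      by (rule card_graft_at_eoc) (use N assms in auto)
    \<comment> \<open>The surviving maximum \<open>N + 1\<close> is moved down to \<open>N\<close>;
      chain ends \<open>k < N\<close> are unaffected.\<close>
    also have "{1..?c} - {?a, ?c} = {1..<?a} \<union> {?b}" using N by auto
    also have "card {E \<in> increasing_trees \<dots>. eoc E = k} =
        card {E \<in> increasing_trees {1..?a}. eoc E = k}"
      by (rule card_eoc_raise_Max) (use N assms in auto)
    finally show ?thesis unfolding g_row_pred_eq_card .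
  qed
  moreover have "card ?B = g_col (n - 1) (int k)"
  proof -
    have V: "{1..?c} - {?a, ?b} = {1..<?a} \<union> {?c}" using N by auto
    \<comment> \<open>The chain end is not the surviving maximum \<open>N + 2\<close>, and every
      other surviving label is below \<open>N\<close>, so it may become the parent of
      \<open>N\<close> and \<open>N + 1\<close>.\<close>
    have less: "eoc E < ?a" if E: "E \<in> increasing_trees ({1..<?a} \<union> {?c})" for E
    proof -
      have "eoc E < ?c" by (rule eoc_less_Max[OF E]) auto
      then show ?thesis using eoc_properties(3)[OF E] by auto
    qed
    have "card ?B = card {E \<in> increasing_trees ({1..?c} - {?a, ?b}). (k, ?c) \<in> E}"
      by (rule card_graft_at_own_eoc) (use N less in \<open>auto simp only: V\<close>, use N in auto)
    \<comment> \<open>Moving the maximum from \<open>N + 2\<close> down to \<open>N\<close> turns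
      the condition on the parent of \<open>N + 2\<close> into one on the parent of the maximum of a
      tree on \<open>{1..N}\<close>.\<close>
    also have "\<dots> = card {E \<in> increasing_trees {1..?a}. (k, ?a) \<in> E}"
      unfolding V by (rule card_parent_raise_Max) (use N assms in auto)
    finally show ?thesis unfolding g_col_pred_eq_card .
  qed
  ultimately show ?thesis by simp
qed

end

theorem theorem2p1:
  fixes n :: nat
  assumes "n \<ge> 2"
  shows
    "((\<forall>m::int. 1 \<le> m \<and> m \<le> 2 * int n \<longrightarrow> g n m (2 * int n) = 0) \<and>
      (\<forall>m::int. 1 \<le> m \<and> m \<le> 2 * int n - 2 \<longrightarrow> g n m (2 * int n - 1) = g_row (n - 1) m) \<and>
      g n (2 * int n - 1) (2 * int n - 1) = 0 \<and>
      g n (2 * int n) (2 * int n - 1) = 0) \<and>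
     ((\<forall>k::int. 1 \<le> k \<and> k \<le> 2 * int n - 2 \<longrightarrow> g n (2 * int n) k = g_row (n - 1) k) \<and>
      g n (2 * int n) (2 * int n - 1) = 0 \<and>
      g n (2 * int n) (2 * int n) = 0 \<and>
      (\<forall>k::int. 1 \<le> k \<and> k \<le> 2 * int n - 2 \<longrightarrow>
         g n (2 * int n - 1) k = g_row (n - 1) k + g_col (n - 1) k) \<and>
      g n (2 * int n - 1) (2 * int n - 1) = 0 \<and>
      g n (2 * int n - 1) (2 * int n) = 0)"
proof -
  define N where "N = 2 * n - 1"
  have N: "2 * n = N + 1" "3 \<le> N" using assms unfolding N_def by linarith+
  then have int: "2 * int n = int (N + 1)" "int (N + 1) - 1 = int N" "int (N + 1) - 2 = int N - 1"
    by linarith+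
  have zero: "g n m (int (N + 1)) = 0" if "1 \<le> m" for m
    using g_pom_penultimate[OF N, of "nat m"] that by simp
  have eqs: "g n m (int N) = g_row (n - 1) m" "g n (int (N + 1)) m = g_row (n - 1) m"
    "g n (int N) m = g_row (n - 1) m + g_col (n - 1) m" if "1 \<le> m" "m \<le> int N - 1" for m
  proof -
    \<comment> \<open>The statement ranges over integers; those between 1 and \<open>N - 1\<close>
      are images of naturals below \<open>N\<close>, where the preceding lemmas apply.\<close>
    obtain m' where m': "m = int m'" "m' < N"
      using \<open>1 \<le> m\<close> \<open>m \<le> int N - 1\<close> by (intro that[of "nat m"]) linarith+
    show "g n m (int N) = g_row (n - 1) m"
      unfolding m'(1) by (rule g_pom_antepenultimate_eq_row[OF N m'(2)])
    show "g n (int (N + 1)) m = g_row (n - 1) m"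
      unfolding m'(1) by (rule g_eoc_penultimate[OF N m'(2)])
    show "g n (int N) m = g_row (n - 1) m + g_col (n - 1) m"
      unfolding m'(1) by (rule g_eoc_antepenultimate[OF N m'(2)])
  qed
  show ?thesis
    unfolding int
    by (intro conjI allI impI; (elim conjE)?;
        rule zero eqs g_diagonal[OF N] g_pom_penultimate[OF N] g_penultimate_antepenultimate[OF N];
        assumption?)
qed

end
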